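(* Let $T=(V,E)$ be a tree whose edges carry nonsingular real $s\times s$ matrix weights $W(e)$, and let $L$ be the Laplacian matrix of $T$. For $v\in V$, let $L_v$ denote the principal submatrix of $L$ obtained by deleting the row block and column block corresponding to $v$. Then for $u,w\in V\setminus\{v\}$, the block at position $(u,w)$ of $L_v^{-1}$ is $$(L_v^{-1})_{uw}=\sum_{e\in\mathcal P(u,v)\cap\mathcal P(w,v)}W(e)^{-1},$$ where $\mathcal P(x,y)$ denotes the path joining the vertices $x$ and $y$ in $T$.
   Context: Laplacian: for a tree on $n$ vertices with $s\times s$ matrix edge weights, $L=[l_{uv}]_{u,v\in V}$ is the $ns\times ns$ block matrix whose $s\times s$ blocks are: for $u\ne v$, $l_{uv}=-W(e)$ if $u,v$ are joined by the edge $e$, and $l_{uv}=\mathbf 0$ if $u,v$ are not adjacent; $l_{vv}$ is the sum of the weights of the edges incident with $v$. The sum is over the edges $e$ common to the two paths (empty sum $=\mathbf 0$). *)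

theory Defs
  imports
    "Jordan_Normal_Form.Gauss_Jordan_Elimination"
    "Jordan_Normal_Form.DL_Submatrix"
begin

text \<open>
  A finite simple graph is given by its vertex set and its set of edges, each edge being the
  two-element set of its end points.  The tree predicate of the AFP entry Graph_Theory is
  not used: it forbids directed cycles, so in a symmetric digraph every single edge
  a--b already yields the forbidden cycle a, b, a.
\<close>

definition simple_graph :: "'a set \<Rightarrow> 'a set set \<Rightarrow> bool" where
  "simple_graph V E \<longleftrightarrow> finite V \<and> E \<subseteq> {{x, y} | x y. x \<in> V \<and> y \<in> V \<and> x \<noteq> y}"

definition path_between :: "'a set \<Rightarrow> 'a set set \<Rightarrow> 'a \<Rightarrow> 'a \<Rightarrow> 'a list \<Rightarrow> bool" where
  "path_between V E x y p \<longleftrightarrow>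
     p \<noteq> [] \<and> hd p = x \<and> last p = y \<and> set p \<subseteq> V \<and> distinct p \<and>
     (\<forall>i. Suc i < length p \<longrightarrow> {p ! i, p ! Suc i} \<in> E)"

definition is_cycle :: "'a set \<Rightarrow> 'a set set \<Rightarrow> 'a list \<Rightarrow> bool" where
  "is_cycle V E c \<longleftrightarrow>
     length c \<ge> 3 \<and> set c \<subseteq> V \<and> distinct c \<and>
     (\<forall>i. Suc i < length c \<longrightarrow> {c ! i, c ! Suc i} \<in> E) \<and> {last c, hd c} \<in> E"

definition is_tree :: "'a set \<Rightarrow> 'a set set \<Rightarrow> bool" where
  "is_tree V E \<longleftrightarrow>
     simple_graph V E \<and> V \<noteq> {} \<and>
     (\<forall>x \<in> V. \<forall>y \<in> V. \<exists>p. path_between V E x y p) \<and>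
     (\<nexists>c. is_cycle V E c)"

text \<open>The edge set of the path joining x and y, which is unique in a tree (and empty if x = y).\<close>

definition path_edges :: "'a set \<Rightarrow> 'a set set \<Rightarrow> 'a \<Rightarrow> 'a \<Rightarrow> 'a set set" where
  "path_edges V E x y =
     (let p = (THE p. path_between V E x y p) in {{p ! i, p ! Suc i} | i. Suc i < length p})"

text \<open>
  Matrices of varying dimension form no additive monoid as a type, so the sum of a family of
  s by s matrices is taken entrywise; over the empty set it is the s by s zero matrix.
\<close>

definition mat_sum :: "nat \<Rightarrow> ('b \<Rightarrow> real mat) \<Rightarrow> 'b set \<Rightarrow> real mat" where
  "mat_sum s f A = mat s s (\<lambda>(i, j). \<Sum>e \<in> A. f e $$ (i, j))"

text \<open>Unspecified if the matrix is not invertible.\<close>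

definition mat_inv :: "real mat \<Rightarrow> real mat" where
  "mat_inv A = the (mat_inverse A)"

text \<open>
  Block matrices whose blocks are indexed by vertices: the vertices are listed, in any order, by a
  distinct list vs, and the vertex at position k of vs owns the indices k * s, ..., k * s + s - 1.
\<close>

definition position :: "'a list \<Rightarrow> 'a \<Rightarrow> nat" where
  "position vs u = (THE k. k < length vs \<and> vs ! k = u)"

definition mat_block :: "nat \<Rightarrow> 'a list \<Rightarrow> real mat \<Rightarrow> 'a \<Rightarrow> 'a \<Rightarrow> real mat" where
  "mat_block s vs A u w =
     mat s s (\<lambda>(i, j). A $$ (position vs u * s + i, position vs w * s + j))"

definition laplacian_block ::
  "nat \<Rightarrow> 'a set set \<Rightarrow> ('a set \<Rightarrow> real mat) \<Rightarrow> 'a \<Rightarrow> 'a \<Rightarrow> real mat" where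
  "laplacian_block s E W u v =
     (if u = v then mat_sum s W {e \<in> E. v \<in> e}
      else if {u, v} \<in> E then - W {u, v}
      else 0\<^sub>m s s)"

definition laplacian ::
  "nat \<Rightarrow> 'a list \<Rightarrow> 'a set set \<Rightarrow> ('a set \<Rightarrow> real mat) \<Rightarrow> real mat" where
  "laplacian s vs E W =
     mat (length vs * s) (length vs * s)
       (\<lambda>(i, j). laplacian_block s E W (vs ! (i div s)) (vs ! (j div s)) $$ (i mod s, j mod s))"

text \<open>
  The blocks of the resulting matrix are indexed by the vertices other than v, in the order in
  which they occur in \<^term>\<open>removeAll v vs\<close>.
\<close>

definition delete_block :: "nat \<Rightarrow> 'a list \<Rightarrow> 'a \<Rightarrow> real mat \<Rightarrow> real mat" where
  "delete_block s vs v A =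
     submatrix A {i. i div s \<noteq> position vs v} {j. j div s \<noteq> position vs v}"

end

theory Submission
  imports Defs "Jordan_Normal_Form.Determinant"
begin

text \<open>
  Root the tree at the deleted vertex \<open>v\<close>, so that every other vertex \<open>c\<close> has a parent and the
  edges are exactly the parent edges \<open>e\<^sub>c\<close>, one for each \<open>c \<noteq> v\<close>
  (\<open>bij_betw_parent_edge\<close>).  Orient each edge from child to parent and let
  \<open>q(x, c) = [x = c] - [x = parent c]\<close> be the resulting signed incidence numbers.  Then the Laplacian
  factors as \<open>L\<^sub>u\<^sub>x = (\<Sum>c. q(u, c) q(x, c) W(e\<^sub>c))\<close>
  (\<open>laplacian_block_eq_sum_incidence\<close>).

  Let \<open>N\<^sub>u\<^sub>w\<close> be the claimed block, the sum of \<open>W(e)\<^sup>-\<^sup>1\<close> over the edges that the paths from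
  \<open>u\<close> and \<open>w\<close> to the root share.  To verify \<open>L\<^sub>v N = 1\<close>, apply \<open>L\<close> to the column \<open>x \<mapsto> N\<^sub>x\<^sub>w\<close>,
  which may be extended to \<open>x = v\<close> because \<open>N\<^sub>v\<^sub>w = 0\<close>.  The inner factor \<open>q(x, c)\<close> takes the
  difference \<open>N\<^sub>c\<^sub>w - N\<^sub>p\<^sub>w\<close> across the edge \<open>e\<^sub>c\<close>, where \<open>p\<close> is the parent of \<open>c\<close>.
  The paths from \<open>c\<close> and \<open>p\<close> to the root differ in \<open>e\<^sub>c\<close> only, so this difference is
  \<open>W(e\<^sub>c)\<^sup>-\<^sup>1\<close> if \<open>e\<^sub>c\<close> lies on the path from \<open>w\<close> to \<open>v\<close> and zero otherwise
  (\<open>path_potential_diff\<close>).  The weights cancel, and what is left is the sum of \<open>q(u, c)\<close> over the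
  edges of the path from \<open>w\<close> to \<open>v\<close>; it telescopes to \<open>[u = w] - [u = v]\<close>
  (\<open>sum_incidence_path\<close>), which is \<open>[u = w]\<close> for \<open>u \<noteq> v\<close>.  A right inverse of a square matrix
  over a field is its inverse.

  It remains to see that deleting the indices of one block from a block matrix yields the block matrix
  over the shortened list of vertices (\<open>delete_block_block_matrix\<close>) and that block matrices
  multiply block by block (\<open>block_matrix_mult_eq_one\<close>).
\<close>

section \<open>Paths in acyclic graphs\<close>

definition walk_edges :: "'a list \<Rightarrow> 'a set set" where
  "walk_edges p = {{p ! i, p ! Suc i} | i. Suc i < length p}"

lemma walk_edges_Cons:
  assumes "p \<noteq> []"
  shows "walk_edges (x # p) = insert {x, hd p} (walk_edges p)"
proof -
  have "walk_edges (x # p) = (\<lambda>i. {(x # p) ! i, (x # p) ! Suc i}) ` {..<length p}"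
    by (auto simp: walk_edges_def)
  also have "{..<length p} = insert 0 (Suc ` {i. Suc i < length p})"
  proof (rule Set.set_eqI)
    fix i
    show "i \<in> {..<length p} \<longleftrightarrow> i \<in> insert 0 (Suc ` {i. Suc i < length p})"
      using assms by (cases i) auto
  qed
  finally show ?thesis
    using assms by (auto simp: walk_edges_def hd_conv_nth image_iff)
qed

lemma walk_edges_singleton [simp]: "walk_edges [x] = {}"
  by (simp add: walk_edges_def)

lemma walk_edge_subset: "e \<in> walk_edges p \<Longrightarrow> e \<subseteq> set p"
  by (auto simp: walk_edges_def)

lemma successively_conv_nth:
  "successively P xs \<longleftrightarrow> (\<forall>i. Suc i < length xs \<longrightarrow> P (xs ! i) (xs ! Suc i))"
proof (induction xs)
  case (Cons x xs)
  have "(\<forall>i. Suc i < length (x # xs) \<longrightarrow> P ((x # xs) ! i) ((x # xs) ! Suc i)) \<longleftrightarrow>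
      (xs = [] \<or> P x (hd xs)) \<and> (\<forall>i. Suc i < length xs \<longrightarrow> P (xs ! i) (xs ! Suc i))"
    by (cases xs) (simp_all add: All_less_Suc2)
  then show ?case
    using Cons by (auto simp: successively_Cons)
qed simp

lemma path_between_iff_successively:
  "path_between V E x y p \<longleftrightarrow>
     p \<noteq> [] \<and> hd p = x \<and> last p = y \<and> set p \<subseteq> V \<and> distinct p \<and>
     successively (\<lambda>a b. {a, b} \<in> E) p"
  by (auto simp: path_between_def successively_conv_nth)

lemma is_cycle_iff_successively:
  "is_cycle V E c \<longleftrightarrow>
     length c \<ge> 3 \<and> set c \<subseteq> V \<and> distinct c \<and>
     successively (\<lambda>a b. {a, b} \<in> E) c \<and> {last c, hd c} \<in> E"
  by (auto simp: is_cycle_def successively_conv_nth)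

lemma path_between_Cons:
  "path_between V E x y (x # p) \<longleftrightarrow>
     x \<in> V \<and> (if p = [] then x = y
              else {x, hd p} \<in> E \<and> x \<notin> set p \<and> path_between V E (hd p) y p)"
  by (auto simp: path_between_iff_successively successively_Cons)

text \<open>
  Two paths that leave their common start through different neighbours meet again at the latest in
  their common end; at the first such meeting point they close up to a cycle.
\<close>

lemma cycle_of_diverging_paths:
  assumes p: "path_between V E x y (x # p)" and q: "path_between V E x y (x # q)"
    and ne: "p \<noteq> []" "q \<noteq> []" "hd p \<noteq> hd q"
  shows "\<exists>c. is_cycle V E c"
proof -
  have "y \<in> set p" "y \<in> set q"
    using p q ne last_in_set[of p] last_in_set[of q] by (auto simp: path_between_def)
  then obtain a z b where ab: "p = a @ z # b" "z \<in> set q" "\<forall>w \<in> set a. w \<notin> set q"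
    using split_list_first_prop[of p "\<lambda>w. w \<in> set q"] by auto
  obtain c d where cd: "q = c @ z # d"
    using ab(2) by (auto dest: split_list)
  have "a \<noteq> [] \<or> c \<noteq> []"
    using ne(3) ab cd by auto
  then have "length (x # a @ z # rev c) \<ge> 3"
    by (auto simp: neq_Nil_conv)
  moreover have "{last (x # a @ z # rev c), x} \<in> E"
    using q cd by (cases c) (auto simp: path_between_iff_successively successively_Cons insert_commute)
  moreover have "successively (\<lambda>a b. {a, b} \<in> E) (x # a @ z # rev c)"
  proof -
    have "successively (\<lambda>a b. {a, b} \<in> E) ((x # a) @ z # b)"
      using p ab by (simp add: path_between_iff_successively)
    moreover have "successively (\<lambda>a b. {a, b} \<in> E) (c @ z # d)"
      using q cd by (auto simp: path_between_iff_successively successively_Cons)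
    then have "successively (\<lambda>a b. {a, b} \<in> E) (c @ [z])"
      by (simp add: successively_append_iff)
    then have "successively (\<lambda>a b. {a, b} \<in> E) (rev (c @ [z]))"
      unfolding successively_rev by (simp add: insert_commute)
    ultimately have "successively (\<lambda>a b. {a, b} \<in> E) ((x # a) @ z # rev c)"
      unfolding successively_append_iff by simp
    then show ?thesis by simp
  qed
  moreover have "set (x # a @ z # rev c) \<subseteq> V" "distinct (x # a @ z # rev c)"
    using p q ab cd by (auto simp: path_between_def)
  ultimately have "is_cycle V E (x # a @ z # rev c)"
    unfolding is_cycle_iff_successively by simp
  then show ?thesis ..
qed

text \<open>
  Without cycles two paths with the same ends take the same first step, hence agree by induction.
\<close>

lemma path_between_unique:
  assumes acyclic: "\<nexists>c. is_cycle V E c"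
    and "path_between V E x y p" "path_between V E x y q"
  shows "p = q"
  using assms(2,3)
proof (induction p arbitrary: x q)
  case Nil
  then show ?case by (simp add: path_between_def)
next
  case (Cons a p)
  from Cons.prems obtain q' where q: "q = x # q'" and a: "a = x"
    by (cases q) (auto simp: path_between_def)
  have paths: "path_between V E x y (x # p)" "path_between V E x y (x # q')"
    using Cons.prems q a by auto
  consider "p = []" | "q' = []" | "p \<noteq> []" "q' \<noteq> []" by blast
  then show ?case
  proof cases
    case 3
    then have "hd p = hd q'"
      using cycle_of_diverging_paths[OF paths] acyclic by blast
    then show ?thesis
      using Cons.IH[of "hd p" q'] paths 3 q a by (auto simp: path_between_Cons)
  qed (use paths q a in \<open>auto simp: path_between_def split: if_splits\<close>)
qed

section \<open>Rooted trees\<close>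

definition parent :: "'a set \<Rightarrow> 'a set set \<Rightarrow> 'a \<Rightarrow> 'a \<Rightarrow> 'a" where
  "parent V E r c = (THE p. path_between V E c r p) ! 1"

definition parent_edge :: "'a set \<Rightarrow> 'a set set \<Rightarrow> 'a \<Rightarrow> 'a \<Rightarrow> 'a set" where
  "parent_edge V E r c = {c, parent V E r c}"

text \<open>The boundary operator of the tree, with the edge above \<open>c\<close> oriented from \<open>c\<close> to its parent.\<close>

definition incidence :: "'a set \<Rightarrow> 'a set set \<Rightarrow> 'a \<Rightarrow> 'a \<Rightarrow> 'a \<Rightarrow> real" where
  "incidence V E r x c =
     (if x = c then 1 else 0) - (if x = parent V E r c then 1 else 0)"

context
  fixes V :: "'a set" and E :: "'a set set" and r :: 'a
  assumes tree: "is_tree V E" and root: "r \<in> V"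
begin

lemma finite_vertices: "finite V"
  using tree by (auto simp: is_tree_def simple_graph_def)

lemma finite_edges: "finite E"
proof (rule finite_subset)
  show "E \<subseteq> Pow V"
    using tree by (auto simp: is_tree_def simple_graph_def)
qed (simp add: finite_vertices)

lemma tree_edge_cases:
  assumes "e \<in> E"
  obtains a b where "e = {a, b}" "a \<in> V" "b \<in> V" "a \<noteq> b"
  using assms tree unfolding is_tree_def simple_graph_def by blast

lemma the_path:
  assumes "path_between V E x y p"
  shows "(THE p. path_between V E x y p) = p"
  using assms tree by (intro the_equality) (auto simp: is_tree_def intro: path_between_unique)

lemma path_edges_eq:
  assumes "path_between V E x y p"
  shows "path_edges V E x y = walk_edges p"
  unfolding path_edges_def walk_edges_def Let_def the_path[OF assms] ..

lemma parent_eq: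
  assumes "path_between V E c r (c # p)" "p \<noteq> []"
  shows "parent V E r c = hd p"
  using assms by (simp add: parent_def the_path hd_conv_nth)

lemma obtain_path_via_parent:
  assumes "c \<in> V" "c \<noteq> r"
  obtains p where "path_between V E c r (c # p)" "path_between V E (parent V E r c) r p"
proof -
  obtain q where q: "path_between V E c r q"
    using tree assms root unfolding is_tree_def by blast
  then obtain p where p: "q = c # p" "p \<noteq> []"
    using assms by (cases q) (fastforce simp: path_between_def)+
  then have "path_between V E (hd p) r p"
    using q by (auto simp: path_between_Cons)
  then show ?thesis
    using that[of p] p q by (simp add: parent_eq)
qed

lemma path_edges_root: "path_edges V E r r = {}"
proof -
  have "path_between V E r r [r]"
    using root by (simp add: path_between_def)
  then show ?thesis
    by (simp add: path_edges_eq)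
qed

text \<open>
  Cutting the first vertex off the path from \<open>c\<close> to the root leaves the path of the parent.  The latter
  avoids \<open>c\<close>, hence also the edge above \<open>c\<close>.
\<close>

lemma
  assumes "c \<in> V" "c \<noteq> r"
  shows parent_in_vertices: "parent V E r c \<in> V"
    and parent_neq: "parent V E r c \<noteq> c"
    and parent_edge_in_edges: "parent_edge V E r c \<in> E"
    and path_edges_parent:
      "path_edges V E c r = insert (parent_edge V E r c) (path_edges V E (parent V E r c) r)"
    and parent_edge_notin: "parent_edge V E r c \<notin> path_edges V E (parent V E r c) r"
proof -
  obtain p where p: "path_between V E c r (c # p)" "path_between V E (parent V E r c) r p"
    using assms by (rule obtain_path_via_parent)
  then have hd: "p \<noteq> []" "hd p = parent V E r c" and "c \<notin> set p"
    by (simp_all add: path_between_def)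
  have "{c, hd p} \<in> E"
    using p hd by (simp add: path_between_Cons)
  moreover have "hd p \<in> set p"
    using hd(1) by simp
  moreover have "set p \<subseteq> V"
    using p(2) by (simp add: path_between_def)
  ultimately show "parent V E r c \<in> V" "parent V E r c \<noteq> c" "parent_edge V E r c \<in> E"
    using hd(2) \<open>c \<notin> set p\<close> by (auto simp: parent_edge_def)
  show "path_edges V E c r = insert (parent_edge V E r c) (path_edges V E (parent V E r c) r)"
    using hd by (simp add: path_edges_eq[OF p(1)] path_edges_eq[OF p(2)] walk_edges_Cons
        parent_edge_def)
  show "parent_edge V E r c \<notin> path_edges V E (parent V E r c) r"
    using \<open>c \<notin> set p\<close> walk_edge_subset[of _ p]
    by (auto simp: path_edges_eq[OF p(2)] parent_edge_def)
qed

text \<open>Iterating the parent function reaches the root, since each step shortens the path to it.\<close>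

lemma root_path_induct [consumes 1, case_names root step]:
  assumes "w \<in> V"
    and base: "P r"
    and step: "\<And>c. c \<in> V \<Longrightarrow> c \<noteq> r \<Longrightarrow> P (parent V E r c) \<Longrightarrow> P c"
  shows "P w"
proof -
  obtain p where "path_between V E w r p"
    using tree root assms(1) unfolding is_tree_def by blast
  then show ?thesis
  proof (induction p arbitrary: w)
    case Nil
    then show ?case by (simp add: path_between_def)
  next
    case (Cons a p)
    from Cons.prems have a: "a = w" "w \<in> V" by (auto simp: path_between_def)
    show ?case
    proof (cases "p = []")
      case True
      then show ?thesis using Cons.prems base by (auto simp: path_between_def)
    next
      case False
      then have "parent V E r w = hd p" "path_between V E (hd p) r p" "w \<noteq> r"
        using Cons.prems a parent_eq[of w p]
        by (auto simp: path_between_Cons) (auto simp: path_between_def)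
      then show ?thesis
        using Cons.IH step a by simp
    qed
  qed
qed

lemma path_edges_subset: "w \<in> V \<Longrightarrow> path_edges V E w r \<subseteq> E"
  by (induction w rule: root_path_induct)
    (auto simp: path_edges_root path_edges_parent parent_edge_in_edges)

lemma finite_path_edges: "w \<in> V \<Longrightarrow> finite (path_edges V E w r)"
  using path_edges_subset finite_edges finite_subset by blast

text \<open>
  Take the path from \<open>b\<close> to the root.  If it avoids \<open>a\<close>, putting \<open>a\<close> in front gives the path of
  \<open>a\<close>.  If it visits \<open>a\<close>, it does so right after \<open>b\<close>, as otherwise its part from \<open>b\<close> to
  \<open>a\<close> and the edge form a cycle.
\<close>

lemma edge_joins_parent:
  assumes "{a, b} \<in> E" "a \<in> V" "b \<in> V" "a \<noteq> b"
  shows "a \<noteq> r \<and> parent V E r a = b \<or> b \<noteq> r \<and> parent V E r b = a"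
proof -
  obtain p where p: "path_between V E b r p"
    using tree root assms(3) unfolding is_tree_def by blast
  show ?thesis
  proof (cases "a \<in> set p")
    case False
    then have "path_between V E a r (a # p)" "p \<noteq> []" "hd p = b"
      using p assms by (auto simp: path_between_Cons) (auto simp: path_between_def)
    then show ?thesis
      using parent_eq[of a p] False by (auto simp: path_between_def)
  next
    case True
    then obtain q where q: "p = b # q"
      using p by (cases p) (auto simp: path_between_def)
    then have "a \<in> set q" using True assms by auto
    then obtain l m where lm: "q = l @ a # m" by (auto dest: split_list)
    have "l = []"
    proof (rule ccontr)
      assume "l \<noteq> []"
      then have "is_cycle V E (b # l @ [a])"
        using p q lm assms
        by (auto simp: is_cycle_iff_successively path_between_iff_successively successively_Cons
            successively_append_iff Suc_le_eq)
      then show False using tree by (auto simp: is_tree_def)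
    qed
    then have hd: "q \<noteq> []" "hd q = a"
      using lm by simp_all
    have "last q = r" "b \<notin> set q"
      using p q hd(1) by (simp_all add: path_between_def)
    then have "b \<noteq> r"
      using hd(1) last_in_set[of q] by auto
    then show ?thesis
      using parent_eq[of b q] p q hd by simp
  qed
qed

text \<open>
  Two vertices with the same parent edge would be parents of each other; then this edge would lie on
  the path from the parent to the root, which avoids it.
\<close>

lemma bij_betw_parent_edge: "bij_betw (parent_edge V E r) (V - {r}) E"
  unfolding bij_betw_def
proof
  show "inj_on (parent_edge V E r) (V - {r})"
  proof (rule inj_onI, rule ccontr)
    fix c d
    assume c: "c \<in> V - {r}" and d: "d \<in> V - {r}" and ne: "c \<noteq> d"
      and eq: "parent_edge V E r c = parent_edge V E r d"
    then have "d = parent V E r c" "c = parent V E r d"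
      by (auto simp: parent_edge_def doubleton_eq_iff)
    then show False
      using c d eq path_edges_parent[of d] parent_edge_notin[of c] by auto
  qed
  show "parent_edge V E r ` (V - {r}) = E"
  proof
    show "E \<subseteq> parent_edge V E r ` (V - {r})"
    proof
      fix e assume "e \<in> E"
      then obtain a b where e: "e = {a, b}" "a \<in> V" "b \<in> V" "a \<noteq> b"
        by (rule tree_edge_cases)
      with \<open>e \<in> E\<close> consider "a \<noteq> r" "parent V E r a = b" | "b \<noteq> r" "parent V E r b = a"
        using edge_joins_parent by blast
      then show "e \<in> parent_edge V E r ` (V - {r})"
        by cases (use e in \<open>force simp: parent_edge_def\<close>)+
    qed
  qed (auto intro: parent_edge_in_edges)
qed

lemma sum_incidence_mult:
  fixes g :: "'a \<Rightarrow> real"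
  assumes "c \<in> V" "c \<noteq> r"
  shows "(\<Sum>x\<in>V. incidence V E r x c * g x) = g c - g (parent V E r c)"
proof -
  have "(\<Sum>x\<in>V. incidence V E r x c * g x) =
      (\<Sum>x\<in>V. if x = c then g x else 0) - (\<Sum>x\<in>V. if x = parent V E r c then g x else 0)"
    unfolding sum_subtractf[symmetric]
    by (intro sum.cong) (auto simp: incidence_def)
  then show ?thesis
    using assms finite_vertices parent_in_vertices by simp
qed

text \<open>
  The boundary of the path from \<open>w\<close> to the root: by induction along the path, each edge adds its lower
  end and cancels the contribution of its upper end.
\<close>

lemma sum_incidence_path:
  assumes "w \<in> V"
  shows "(\<Sum>c\<in>V - {r}. if parent_edge V E r c \<in> path_edges V E w r then incidence V E r u c else 0)
    = (if u = w then 1 else 0) - (if u = r then 1 else 0)"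
  using assms
proof (induction w rule: root_path_induct)
  case root
  show ?case by (simp add: path_edges_root)
next
  case (step d)
  have mem: "parent_edge V E r c \<in> path_edges V E d r \<longleftrightarrow>
      c = d \<or> parent_edge V E r c \<in> path_edges V E (parent V E r d) r"
    if "c \<in> V - {r}" for c
    using that step.hyps bij_betw_parent_edge
    by (auto simp: path_edges_parent bij_betw_def inj_on_def)
  have "(\<Sum>c\<in>V - {r}. if parent_edge V E r c \<in> path_edges V E d r then incidence V E r u c else 0)
    = (\<Sum>c\<in>V - {r}. (if c = d then incidence V E r u c else 0) +
        (if parent_edge V E r c \<in> path_edges V E (parent V E r d) r then incidence V E r u c else 0))"
    using step.hyps by (intro sum.cong refl) (auto simp: mem parent_edge_notin)
  also have "\<dots> = incidence V E r u d + ((if u = parent V E r d then 1 else 0) - (if u = r then 1 else 0))"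
    using step finite_vertices by (simp add: sum.distrib)
  finally show ?case
    by (simp add: incidence_def)
qed

text \<open>
  The sum of \<open>f\<close> over the path to the root is a potential on the vertices whose drop across an edge is
  the value of \<open>f\<close> there; the set \<open>S\<close> switches off the other edges.
\<close>

lemma path_potential_diff:
  fixes f :: "'a set \<Rightarrow> real"
  assumes "c \<in> V" "c \<noteq> r"
  shows "(\<Sum>e\<in>path_edges V E c r \<inter> S. f e) - (\<Sum>e\<in>path_edges V E (parent V E r c) r \<inter> S. f e)
    = (if parent_edge V E r c \<in> S then f (parent_edge V E r c) else 0)"
  using assms finite_path_edges[OF parent_in_vertices] parent_edge_notin
  by (simp add: path_edges_parent Int_insert_left)

text \<open>
  The product of the incidence numbers of \<open>u\<close> and \<open>x\<close> with an edge does not depend on its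
  orientation: it is \<open>1\<close> if \<open>u = x\<close> lies on the edge, \<open>-1\<close> if the edge joins \<open>u\<close> and \<open>x\<close>,
  and \<open>0\<close> otherwise.  The sum over all edges, weighted by \<open>W\<close>, is then the defining formula of
  the Laplacian.
\<close>

lemma laplacian_block_eq_sum_incidence:
  assumes W: "\<And>e. e \<in> E \<Longrightarrow> W e \<in> carrier_mat s s"
    and "u \<in> V" "x \<in> V" "i < s" "j < s"
  shows "laplacian_block s E W u x $$ (i, j) =
    (\<Sum>c\<in>V - {r}. W (parent_edge V E r c) $$ (i, j) * incidence V E r u c * incidence V E r x c)"
proof -
  define k :: "'a set \<Rightarrow> real" where
    "k e = (if u = x then if u \<in> e then 1 else 0 else if e = {u, x} then - 1 else 0)" for e
  have k: "incidence V E r u c * incidence V E r x c = k (parent_edge V E r c)"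
    if "c \<in> V - {r}" for c
  proof -
    define p where "p = parent V E r c"
    have "p \<noteq> c"
      using that parent_neq by (simp add: p_def)
    then show ?thesis
      unfolding k_def incidence_def parent_edge_def p_def[symmetric]
      by (auto simp: doubleton_eq_iff)
  qed
  have "(\<Sum>c\<in>V - {r}. W (parent_edge V E r c) $$ (i, j) * incidence V E r u c * incidence V E r x c)
    = (\<Sum>c\<in>V - {r}. W (parent_edge V E r c) $$ (i, j) * k (parent_edge V E r c))"
    by (intro sum.cong refl) (simp add: k mult.assoc)
  also have "\<dots> = (\<Sum>e\<in>E. W e $$ (i, j) * k e)"
    by (rule sum.reindex_bij_betw[OF bij_betw_parent_edge])
  also have "\<dots> = laplacian_block s E W u x $$ (i, j)"
  proof (cases "u = x")
    case True
    have "(\<Sum>e\<in>E. W e $$ (i, j) * k e) = (\<Sum>e\<in>{e \<in> E. u \<in> e}. W e $$ (i, j))"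
      using finite_edges True by (auto simp: k_def sum.inter_filter intro!: sum.cong)
    then show ?thesis
      using assms True by (simp add: laplacian_block_def mat_sum_def)
  next
    case False
    have "(\<Sum>e\<in>E. W e $$ (i, j) * k e) = (\<Sum>e\<in>E. if e = {u, x} then - W e $$ (i, j) else 0)"
      using False by (auto simp: k_def intro!: sum.cong)
    then show ?thesis
      using assms False finite_edges carrier_matD[OF W, of "{u, x}"]
      by (auto simp: laplacian_block_def)
  qed
  finally show ?thesis ..
qed

end

section \<open>Block matrices\<close>

lemma mat_inv_eqI:
  fixes A :: "real mat"
  assumes A: "A \<in> carrier_mat n n" and B: "B \<in> carrier_mat n n" and AB: "A * B = 1\<^sub>m n"
  shows "invertible_mat A" and "mat_inv A = B"
proof -
  have BA: "B * A = 1\<^sub>m n"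
    using A B AB by (rule mat_mult_left_right_inverse)
  then show "invertible_mat A"
    using A B AB by (auto simp: invertible_mat_def inverts_mat_def)
  have "A \<in> Units (ring_mat TYPE(real) n ())"
    using A B AB BA by (auto simp: Units_def ring_mat_def)
  then obtain C where C: "mat_inverse A = Some C"
    using mat_inverse(1)[OF A, where b = "()"] by (cases "mat_inverse A") auto
  then have "A * C = 1\<^sub>m n" "C \<in> carrier_mat n n"
    using mat_inverse(2)[OF A] by auto
  then have "C = B"
    using A B BA by (metis assoc_mult_mat left_mult_one_mat right_mult_one_mat)
  then show "mat_inv A = B"
    by (simp add: mat_inv_def C)
qed

lemma mat_inv_right_inverse:
  assumes A: "A \<in> carrier_mat n n" and inv: "invertible_mat A"
  shows "mat_inv A \<in> carrier_mat n n" "A * mat_inv A = 1\<^sub>m n"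
proof -
  obtain B where B: "A * B = 1\<^sub>m n" "B * A = 1\<^sub>m (dim_row B)"
    using A inv by (auto simp: invertible_mat_def inverts_mat_def)
  have "B \<in> carrier_mat n n"
    using A arg_cong[OF B(1), of dim_col] arg_cong[OF B(2), of dim_col] by auto
  then show "mat_inv A \<in> carrier_mat n n" "A * mat_inv A = 1\<^sub>m n"
    using mat_inv_eqI(2)[OF A _ B(1)] B(1) by auto
qed

definition block_matrix ::
  "nat \<Rightarrow> 'a list \<Rightarrow> ('a \<Rightarrow> 'a \<Rightarrow> real mat) \<Rightarrow> real mat" where
  "block_matrix s us F =
     mat (length us * s) (length us * s)
       (\<lambda>(i, j). F (us ! (i div s)) (us ! (j div s)) $$ (i mod s, j mod s))"

lemma laplacian_eq_block_matrix: "laplacian s vs E W = block_matrix s vs (laplacian_block s E W)"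
  by (simp add: laplacian_def block_matrix_def)

lemma block_matrix_carrier [simp]:
  "block_matrix s us F \<in> carrier_mat (length us * s) (length us * s)"
  by (simp add: block_matrix_def)

lemma position_nth:
  assumes "distinct us" "k < length us"
  shows "position us (us ! k) = k"
  using assms unfolding position_def by (intro the_equality) (auto simp: nth_eq_iff_index_eq)

lemma block_index_less:
  fixes k n i s :: nat
  assumes "k < n" "i < s"
  shows "k * s + i < n * s"
proof -
  have "k * s + i < Suc k * s" using assms by simp
  also have "\<dots> \<le> n * s" using assms by (intro mult_right_mono) auto
  finally show ?thesis .
qed

lemma mat_block_block_matrix:
  assumes "distinct us" "u \<in> set us" "w \<in> set us" "F u w \<in> carrier_mat s s"
  shows "mat_block s us (block_matrix s us F) u w = F u w"
proof -
  obtain k l where "k < length us" "us ! k = u" "l < length us" "us ! l = w"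
    using assms by (auto simp: in_set_conv_nth)
  then have "position us u = k" "position us w = l"
    and "\<And>i. i < s \<Longrightarrow> k * s + i < length us * s" "\<And>i. i < s \<Longrightarrow> l * s + i < length us * s"
    using assms position_nth[of us] by (auto intro: block_index_less)
  then show ?thesis
    using assms \<open>us ! k = u\<close> \<open>us ! l = w\<close>
    by (intro eq_matI) (auto simp: mat_block_def block_matrix_def)
qed

text \<open>
  The criterion compares entries rather than blocks, so that the sums run over real numbers: matrices of
  varying dimension form no additive monoid.
\<close>

lemma block_matrix_mult_eq_one:
  assumes dist: "distinct us"
    and FG: "\<And>u w i j. u \<in> set us \<Longrightarrow> w \<in> set us \<Longrightarrow> i < s \<Longrightarrow> j < s \<Longrightarrow>
      (\<Sum>x\<in>set us. \<Sum>a<s. F u x $$ (i, a) * G x w $$ (a, j)) = (if u = w \<and> i = j then 1 else 0)"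
  shows "block_matrix s us F * block_matrix s us G = 1\<^sub>m (length us * s)"
proof (rule eq_matI)
  let ?n = "length us"
  fix i j assume "i < dim_row (1\<^sub>m (?n * s))" "j < dim_col (1\<^sub>m (?n * s))"
  then have ij: "i < ?n * s" "j < ?n * s" by auto
  then have s: "s > 0" by (cases s) auto
  have div: "i div s < ?n" "j div s < ?n" and mod: "i mod s < s" "j mod s < s"
    using ij s by (auto simp: less_mult_imp_div_less)
  have *: "sum f {k * s..<k * s + s} = (\<Sum>a<s. f (k * s + a))" for f :: "nat \<Rightarrow> real" and k
    using sum.shift_bounds_nat_ivl[of f 0 "k * s" s] by (simp add: add.commute lessThan_atLeast0)
  have "(block_matrix s us F * block_matrix s us G) $$ (i, j) =
      (\<Sum>m<?n * s. F (us ! (i div s)) (us ! (m div s)) $$ (i mod s, m mod s) *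
                  G (us ! (m div s)) (us ! (j div s)) $$ (m mod s, j mod s))"
    using ij by (simp add: block_matrix_def scalar_prod_def lessThan_atLeast0)
  also have "\<dots> = (\<Sum>k<?n. \<Sum>a<s. F (us ! (i div s)) (us ! k) $$ (i mod s, a) *
                  G (us ! k) (us ! (j div s)) $$ (a, j mod s))"
    unfolding sum.nat_group[symmetric] * by (intro sum.cong refl) simp
  also have "\<dots> = (\<Sum>x\<in>set us. \<Sum>a<s. F (us ! (i div s)) x $$ (i mod s, a) *
                  G x (us ! (j div s)) $$ (a, j mod s))"
    by (rule sum.reindex_bij_betw[OF bij_betw_nth]) (use dist in auto)
  also have "\<dots> = (if us ! (i div s) = us ! (j div s) \<and> i mod s = j mod s then 1 else 0)"
    using div mod by (intro FG) auto
  also have "\<dots> = (if i = j then 1 else 0)"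
    using dist div by (auto simp: nth_eq_iff_index_eq) (metis div_mult_mod_eq)
  finally show "(block_matrix s us F * block_matrix s us G) $$ (i, j) = 1\<^sub>m (?n * s) $$ (i, j)"
    using ij by simp
qed (simp_all add: block_matrix_def)

lemma card_indices_outside_block:
  fixes s k j :: nat
  assumes "s > 0"
  shows "card {a \<in> {i. i div s \<noteq> k}. a < j} =
    (if j < k * s then j else if j < k * s + s then k * s else j - s)"
proof -
  have iff: "a div s \<noteq> k \<longleftrightarrow> a < k * s \<or> k * s + s \<le> a" for a
    using div_less_iff_less_mult[OF assms, of a k] less_eq_div_iff_mult_less_eq[OF assms, of "Suc k" a]
    by (auto simp: neq_iff Suc_le_eq add.commute)
  have "{a \<in> {i. i div s \<noteq> k}. a < j} = {..<min j (k * s)} \<union> {k * s + s..<j}"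
    by (auto simp: iff)
  also have "card \<dots> = min j (k * s) + (j - (k * s + s))"
    by (subst card_Un_disjoint) auto
  finally show ?thesis by auto
qed

text \<open>
  The increasing enumeration of the indices outside block \<open>k\<close>: an element of a set is enumerated at
  the number of smaller elements, so counting those identifies the value.
\<close>

lemma pick_outside_block:
  fixes s k j :: nat
  assumes s: "s > 0"
  shows "pick {i. i div s \<noteq> k} j = (if j < k * s then j else j + s)"
proof -
  let ?i = "if j < k * s then j else j + s"
  have "?i div s \<noteq> k"
    using s by (auto simp: div_less_iff_less_mult[symmetric])
  then have "pick {i. i div s \<noteq> k} (card {a \<in> {i. i div s \<noteq> k}. a < ?i}) = ?i"
    by (intro pick_card_in_set) simp
  moreover have "card {a \<in> {i. i div s \<noteq> k}. a < ?i} = j"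
    unfolding card_indices_outside_block[OF s] by auto
  ultimately show ?thesis by simp
qed

lemma delete_block_block_matrix:
  assumes dist: "distinct vs" and v: "v \<in> set vs"
  shows "delete_block s vs v (block_matrix s vs F) = block_matrix s (removeAll v vs) F"
proof (cases "s = 0")
  \<comment> \<open>For \<open>s = 0\<close> the quotient \<open>i div s\<close> says nothing about blocks, but all matrices are empty.\<close>
  case True
  then show ?thesis
    by (intro eq_matI) (auto simp: delete_block_def submatrix_def block_matrix_def)
next
  case False
  then have s: "s > 0" by simp
  obtain xs ys where vs: "vs = xs @ v # ys"
    using v by (auto dest: split_list)
  then have rem: "removeAll v vs = xs @ ys" and pos: "position vs v = length xs"
    using dist position_nth[of vs "length xs"] by (auto simp: removeAll_append)
  let ?I = "{i. i div s \<noteq> length xs}"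
  let ?n = "length (xs @ ys) * s"
  have card: "card {i. i < length vs * s \<and> i div s \<noteq> length xs} = ?n"
    using card_indices_outside_block[OF s, of "length xs" "length vs * s"] 
    by (simp add: vs conj_commute algebra_simps)
  \<comment> \<open>Skipping \<open>s\<close> indices moves past one entry of \<open>vs\<close> and keeps the offset within the block.\<close>
  have nth: "vs ! (pick ?I i div s) = (xs @ ys) ! (i div s)" "pick ?I i mod s = i mod s"
    "pick ?I i < length vs * s" if "i < ?n" for i
  proof -
    have "i div s < length xs \<longleftrightarrow> i < length xs * s"
      using s by (rule div_less_iff_less_mult)
    then show "vs ! (pick ?I i div s) = (xs @ ys) ! (i div s)" "pick ?I i mod s = i mod s"
      using s by (auto simp: pick_outside_block vs nth_append Suc_diff_le)
    show "pick ?I i < length vs * s"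
      using that s by (simp add: pick_outside_block vs algebra_simps)
  qed
  show ?thesis
    unfolding delete_block_def pos rem
    by (intro eq_matI) (auto simp: submatrix_def block_matrix_def card nth conj_commute)
qed

section \<open>The inverse of the reduced Laplacian\<close>

theorem theorem2p5:
  fixes V :: "'a set" and E :: "'a set set" and W :: "'a set \<Rightarrow> real mat"
    and s :: nat and vs :: "'a list" and v :: 'a
  assumes tree: "is_tree V E"
    and weights: "\<And>e. e \<in> E \<Longrightarrow> W e \<in> carrier_mat s s \<and> invertible_mat (W e)"
    and ordering: "distinct vs" "set vs = V"
    and v: "v \<in> V"
  shows "invertible_mat (delete_block s vs v (laplacian s vs E W)) \<and>
    (\<forall>u \<in> V - {v}. \<forall>w \<in> V - {v}.
       mat_block s (removeAll v vs) (mat_inv (delete_block s vs v (laplacian s vs E W))) u w =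
         mat_sum s (\<lambda>e. mat_inv (W e)) (path_edges V E u v \<inter> path_edges V E w v))"
proof -
  note tr = tree v
  define N where
    "N u w = mat_sum s (\<lambda>e. mat_inv (W e)) (path_edges V E u v \<inter> path_edges V E w v)" for u w
  let ?us = "removeAll v vs"
  let ?n = "length ?us * s"
  let ?\<epsilon> = "parent_edge V E v" and ?q = "incidence V E v"
  have us: "distinct ?us" "set ?us = V - {v}"
    using ordering by (auto simp: distinct_removeAll)
  have W: "W e \<in> carrier_mat s s" if "e \<in> E" for e
    using weights that by blast
  have L: "delete_block s vs v (laplacian s vs E W) = block_matrix s ?us (laplacian_block s E W)"
    using ordering v by (simp add: laplacian_eq_block_matrix delete_block_block_matrix)
  have N_carrier: "N u w \<in> carrier_mat s s" for u w
    by (simp add: N_def mat_sum_def)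
  have inverse_entry: "(\<Sum>a<s. W e $$ (i, a) * mat_inv (W e) $$ (a, j)) = (if i = j then 1 else 0)"
    if "e \<in> E" "i < s" "j < s" for e i j
  proof -
    have "mat_inv (W e) \<in> carrier_mat s s" "(W e * mat_inv (W e)) $$ (i, j) = 1\<^sub>m s $$ (i, j)"
      using mat_inv_right_inverse[of "W e" s] weights that(1) by auto
    then show ?thesis
      using that W[OF that(1)] by (simp add: scalar_prod_def lessThan_atLeast0)
  qed
  have entry: "(\<Sum>x\<in>set ?us. \<Sum>a<s. laplacian_block s E W u x $$ (i, a) * N x w $$ (a, j))
      = (if u = w \<and> i = j then 1 else 0)"
    if u: "u \<in> set ?us" and w: "w \<in> set ?us" and ij: "i < s" "j < s" for u w i j
  proof -
    have uw: "u \<in> V" "w \<in> V" "u \<noteq> v" using u w us by auto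
    have root: "N v w $$ (a, j) = 0" if "a < s" for a
      using that ij by (simp add: N_def mat_sum_def path_edges_root[OF tr])
    have diff: "N c w $$ (a, j) - N (parent V E v c) w $$ (a, j) =
        (if ?\<epsilon> c \<in> path_edges V E w v then mat_inv (W (?\<epsilon> c)) $$ (a, j) else 0)"
      if "a < s" "c \<in> V - {v}" for a c
      using that ij path_potential_diff[OF tr] by (simp add: N_def mat_sum_def)
    have "(\<Sum>x\<in>set ?us. \<Sum>a<s. laplacian_block s E W u x $$ (i, a) * N x w $$ (a, j))
        = (\<Sum>x\<in>V. \<Sum>a<s. laplacian_block s E W u x $$ (i, a) * N x w $$ (a, j))"
      unfolding us using finite_vertices[OF tr] by (intro sum.mono_neutral_left) (auto simp: root)
    also have "\<dots> = (\<Sum>x\<in>V. \<Sum>a<s. \<Sum>c\<in>V - {v}.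
        W (?\<epsilon> c) $$ (i, a) * ?q u c * (?q x c * N x w $$ (a, j)))"
      using ij uw
      by (intro sum.cong refl)
        (simp add: laplacian_block_eq_sum_incidence[OF tr W] sum_distrib_right mult.assoc)
    also have "\<dots> = (\<Sum>a<s. \<Sum>x\<in>V. \<Sum>c\<in>V - {v}.
        W (?\<epsilon> c) $$ (i, a) * ?q u c * (?q x c * N x w $$ (a, j)))"
      by (rule sum.swap)
    also have "\<dots> = (\<Sum>a<s. \<Sum>c\<in>V - {v}. \<Sum>x\<in>V.
        W (?\<epsilon> c) $$ (i, a) * ?q u c * (?q x c * N x w $$ (a, j)))"
      by (rule sum.cong[OF refl], rule sum.swap)
    also have "\<dots> = (\<Sum>a<s. \<Sum>c\<in>V - {v}. W (?\<epsilon> c) $$ (i, a) * ?q u c *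
        (N c w $$ (a, j) - N (parent V E v c) w $$ (a, j)))"
      by (simp add: sum_distrib_left[symmetric] sum_incidence_mult[OF tr])
    \<comment> \<open>Only edges on the path of \<open>w\<close> survive, each with the product of its weight and the inverse.\<close>
    also have "\<dots> = (\<Sum>c\<in>V - {v}. if ?\<epsilon> c \<in> path_edges V E w v then ?q u c *
        (\<Sum>a<s. W (?\<epsilon> c) $$ (i, a) * mat_inv (W (?\<epsilon> c)) $$ (a, j)) else 0)"
      by (subst sum.swap, intro sum.cong refl) (auto simp: diff sum_distrib_left mult_ac)
    also have "\<dots> = (\<Sum>c\<in>V - {v}. if ?\<epsilon> c \<in> path_edges V E w v then ?q u c else 0) *
        (if i = j then 1 else 0)"
      unfolding sum_distrib_right
      by (intro sum.cong refl) (use ij in \<open>simp add: inverse_entry parent_edge_in_edges[OF tr]\<close>)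
    also have "\<dots> = (if u = w \<and> i = j then 1 else 0)"
      using uw by (simp add: sum_incidence_path[OF tr])
    finally show ?thesis .
  qed
  have "block_matrix s ?us (laplacian_block s E W) * block_matrix s ?us N = 1\<^sub>m ?n"
    using us(1) entry by (intro block_matrix_mult_eq_one)
  note inv = mat_inv_eqI[OF block_matrix_carrier block_matrix_carrier this]
  show ?thesis
    unfolding L inv(2) using inv(1) us N_carrier
    by (simp add: mat_block_block_matrix N_def)
qed

end
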